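(* Let $p$ be a prime and let $G$ be any finite abelian $p$-group with exponent $p^\alpha$. Then the strong metric dimension of $\mathcal{P}_e(G)$ is (i) $|G|-(\alpha+1)$ if $G$ is non-cyclic; (ii) $|G|-1$ if $G$ is cyclic.
   Context: The enhanced power graph $\mathcal{P}_e(G)$ of a group $G$ is the simple undirected graph with vertex set $G$ in which two distinct vertices are adjacent if and only if they belong to a common cyclic subgroup of $G$. The exponent of $G$ is the least common multiple of the orders of its elements. For vertices $u,v$ of a graph $\Gamma$, a vertex $z$ strongly resolves $u$ and $v$ if there is a shortest path from $z$ to $u$ containing $v$, or a shortest path from $z$ to $v$ containing $u$. A set $U$ of vertices is a strong resolving set if every pair of (distinct) vertices of $\Gamma$ is strongly resolved by some vertex of $U$. The strong metric dimension $\operatorname{sdim}(\Gamma)$ is the least cardinality of a strong resolving set of $\Gamma$. *)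

theory Defs
  imports
    "HOL-Algebra.Elementary_Groups"
    "HOL-Algebra.Multiplicative_Group"
    "HOL-Computational_Algebra.Primes"
    "Graph_Theory.Pair_Digraph"
begin

definition group_exponent :: "('a, 'b) monoid_scheme \<Rightarrow> nat" where
  "group_exponent G = Lcm (group.ord G ` carrier G)"

text \<open>Following the graph library, an undirected edge is a pair of opposite arcs.\<close>

definition enhanced_power_graph :: "('a, 'b) monoid_scheme \<Rightarrow> 'a pair_pre_digraph" where
  "enhanced_power_graph G =
     \<lparr> pverts = carrier G,
       parcs = {(x, y). x \<in> carrier G \<and> y \<in> carrier G \<and> x \<noteq> y \<and>
         (\<exists>H. subgroup H G \<and> cyclic_group (G\<lparr>carrier := H\<rparr>) \<and> x \<in> H \<and> y \<in> H)} \<rparr>"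

lemma pair_graph_enhanced_power_graph:
  assumes "finite (carrier G)"
  shows "pair_graph (enhanced_power_graph G)"
proof
  show "finite (parcs (enhanced_power_graph G))"
    by (rule finite_subset[of _ "carrier G \<times> carrier G"])
       (auto simp: enhanced_power_graph_def assms)
  show "symmetric (with_proj (enhanced_power_graph G))"
    by (auto simp: symmetric_def sym_def enhanced_power_graph_def)
qed (auto simp: enhanced_power_graph_def assms)

definition shortest_path ::
  "('a, 'b) pre_digraph \<Rightarrow> 'a \<Rightarrow> 'b awalk \<Rightarrow> 'a \<Rightarrow> bool" where
  "shortest_path \<Gamma> u q v \<longleftrightarrow>
     pre_digraph.apath \<Gamma> u q v \<and>
     (\<forall>r. pre_digraph.apath \<Gamma> u r v \<longrightarrow> length q \<le> length r)"

definition strongly_resolves ::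
  "('a, 'b) pre_digraph \<Rightarrow> 'a \<Rightarrow> 'a \<Rightarrow> 'a \<Rightarrow> bool" where
  "strongly_resolves \<Gamma> z u v \<longleftrightarrow>
     (\<exists>q. shortest_path \<Gamma> z q u \<and> v \<in> set (pre_digraph.awalk_verts \<Gamma> z q)) \<or>
     (\<exists>q. shortest_path \<Gamma> z q v \<and> u \<in> set (pre_digraph.awalk_verts \<Gamma> z q))"

definition strong_resolving_set :: "('a, 'b) pre_digraph \<Rightarrow> 'a set \<Rightarrow> bool" where
  "strong_resolving_set \<Gamma> U \<longleftrightarrow>
     U \<subseteq> verts \<Gamma> \<and>
     (\<forall>u\<in>verts \<Gamma>. \<forall>v\<in>verts \<Gamma>. u \<noteq> v \<longrightarrow> (\<exists>z\<in>U. strongly_resolves \<Gamma> z u v))"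

text \<open>Finiteness of \<open>U\<close> is required because \<open>card\<close> is \<open>0\<close> on infinite sets.\<close>

definition strong_metric_dimension :: "('a, 'b) pre_digraph \<Rightarrow> nat" where
  "strong_metric_dimension \<Gamma> =
     (LEAST n. \<exists>U. strong_resolving_set \<Gamma> U \<and> finite U \<and> card U = n)"

end

theory Submission
  imports Defs
begin

text \<open>The identity is adjacent to every other vertex, so the graph has diameter at most 2, and a third vertex \<open>z\<close>
strongly resolves \<open>u\<close>, \<open>v\<close> iff \<open>u\<close>, \<open>v\<close> are adjacent and \<open>z\<close> is adjacent to exactly one of them. Hence
\<open>U\<close> is strongly resolving iff its complement is a clique no two of whose members have the same closed
neighbourhood. In a \<open>p\<close>-group two vertices are adjacent iff one is a power of the other, so such a
clique has at most one element of each order, i.e. at most \<open>\<alpha> + 1\<close> elements. Let \<open>x\<close> have order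
\<open>p ^ \<alpha>\<close>. In the non-cyclic abelian case some \<open>y\<close> of order \<open>p\<close> lies outside the subgroup generated by
\<open>x\<close>, and \<open>x [^] p ^ (l - 1) \<otimes> y\<close> separates \<open>x [^] p ^ l\<close> from each \<open>x [^] p ^ k\<close> with \<open>k < l\<close>; so the
iterated \<open>p\<close>-th powers of \<open>x\<close> attain the bound. In the cyclic case the graph is complete.\<close>

section \<open>Strong resolution in graphs with a dominating vertex\<close>

lemma strongly_resolves_commute:
  "strongly_resolves \<Gamma> z u v \<longleftrightarrow> strongly_resolves \<Gamma> z v u"
  unfolding strongly_resolves_def by auto

context pair_graph
begin

section \<open>Arcs and short paths in a simple graph\<close>

lemma arc_sym: "(u, v) \<in> parcs G \<Longrightarrow> (v, u) \<in> parcs G"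
  using pair_sym_arcs by (auto simp: symmetric_def dest: symD)

lemma arc_neq: "(u, v) \<in> parcs G \<Longrightarrow> u \<noteq> v"
  using pair_no_loops by fastforce

lemma apath_Nil: "apath u [] v \<longleftrightarrow> u = v \<and> u \<in> pverts G"
  by (rule apath_Nil_iff)

lemma apath_Cons:
  "apath u (a # es) w \<longleftrightarrow>
     a \<in> parcs G \<and> fst a = u \<and> apath (snd a) es w \<and> u \<notin> set (pawalk_verts (snd a) es)"
  by (auto simp: apath_Cons_iff)

lemma apath_arc: "(u, v) \<in> parcs G \<Longrightarrow> apath u [(u, v)] v"
  by (auto simp: apath_Nil apath_Cons arc_neq in_arcsD2)

lemma apath_two_arcs:
  "(u, v) \<in> parcs G \<Longrightarrow> (v, w) \<in> parcs G \<Longrightarrow> u \<noteq> w \<Longrightarrow> apath u [(u, v), (v, w)] w"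
  by (auto simp: apath_Nil apath_Cons arc_neq in_arcsD2)

lemma shortest_path_exists:
  assumes "apath u q v"
  shows "\<exists>r. shortest_path (with_proj G) u r v"
  using ex_has_least_nat[of "\<lambda>r. apath u r v" q length] assms
  unfolding shortest_path_def by auto

text \<open>Every path from \<open>u\<close> contains \<open>u\<close>. Hence a pair that meets the
  candidate set is resolved by its own member, and only pairs in the complement impose
  conditions.\<close>

lemma strongly_resolves_endpoint:
  assumes "apath u q v"
  shows "strongly_resolves (with_proj G) u u v"
proof -
  from shortest_path_exists[OF assms] obtain r where r: "shortest_path (with_proj G) u r v"
    by blast
  then have "apath u r v"
    by (simp add: shortest_path_def)
  then have "u \<in> set (pawalk_verts u r)"
    by (rule hd_in_awalk_verts)
  with r show ?thesis
    unfolding strongly_resolves_def awalk_verts_with_proj_eq by blast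
qed

text \<open>Distinct non-adjacent vertices have distance at least 2, so the path \<open>z\<close>,
  \<open>v\<close>, \<open>u\<close> is already shortest.\<close>

lemma strongly_resolves_if_arcs:
  assumes "(z, v) \<in> parcs G" "(v, u) \<in> parcs G" "(z, u) \<notin> parcs G" "z \<noteq> u"
  shows "strongly_resolves (with_proj G) z u v"
proof -
  have "2 \<le> length r" if "apath z r u" for r
  proof (cases r)
    case Nil
    with that assms(4) show ?thesis by (simp add: apath_Nil)
  next
    case (Cons a es)
    with that assms(3) have "es \<noteq> []"
      by (cases a) (auto simp: apath_Nil apath_Cons)
    with Cons show ?thesis by (cases es) auto
  qed
  then have "shortest_path (with_proj G) z [(z, v), (v, u)] u"
    using apath_two_arcs[OF assms(1,2,4)] by (simp add: shortest_path_def numeral_2_eq_2)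
  then show ?thesis
    unfolding strongly_resolves_def awalk_verts_with_proj_eq by fastforce
qed

text \<open>A detour through the dominating vertex \<open>e\<close> bounds all distances by 2, so a
  shortest path with an inner vertex consists of exactly two arcs.\<close>

lemma inner_vertex_of_shortest_path:
  assumes dom: "\<And>v. v \<in> pverts G \<Longrightarrow> v \<noteq> e \<Longrightarrow> (e, v) \<in> parcs G"
    and q: "shortest_path (with_proj G) z q u"
    and v: "v \<in> set (pawalk_verts z q)" "v \<noteq> z" "v \<noteq> u"
  shows "(v, u) \<in> parcs G \<and> (z, v) \<in> parcs G \<and> (z, u) \<notin> parcs G"
proof -
  have ap: "apath z q u" and min: "\<And>r. apath z r u \<Longrightarrow> length q \<le> length r"
    using q by (auto simp: shortest_path_def)
  obtain a es where q1: "q = a # es"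
    using v by (cases q) auto
  obtain b fs where q2: "es = b # fs"
    using v ap by (cases es) (auto simp: q1 apath_Nil apath_Cons)
  have zu: "z \<in> pverts G" "u \<in> pverts G"
    using ap awalk_hd_in_verts awalk_last_in_verts unfolding apath_def by blast+
  have "z \<noteq> u"
    using min[of "[]"] zu q1 by (auto simp: apath_Nil)
  have nadj: "(z, u) \<notin> parcs G"
    using min[OF apath_arc] by (auto simp: q1 q2)
  \<comment> \<open>If \<open>z\<close> or \<open>u\<close> were \<open>e\<close>, then
    \<open>dom\<close> would make them adjacent, against \<open>nadj\<close>. So the detour through
    \<open>e\<close> is a genuine path of two arcs.\<close>
  have "z \<noteq> e" "u \<noteq> e"
    using nadj dom[of u] dom[of z] zu \<open>z \<noteq> u\<close> arc_sym by blast+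
  then have "apath z [(z, e), (e, u)] u"
    using dom zu \<open>z \<noteq> u\<close> by (intro apath_two_arcs) (auto intro: arc_sym)
  then have "fs = []"
    using min by (fastforce simp: q1 q2)
  with ap v nadj show ?thesis
    by (cases a; cases b) (auto simp: q1 q2 apath_Nil apath_Cons)
qed

theorem strongly_resolves_iff:
  assumes "\<And>v. v \<in> pverts G \<Longrightarrow> v \<noteq> e \<Longrightarrow> (e, v) \<in> parcs G"
    and "z \<noteq> u" "z \<noteq> v" "u \<noteq> v"
  shows "strongly_resolves (with_proj G) z u v \<longleftrightarrow>
    (u, v) \<in> parcs G \<and> ((z, u) \<in> parcs G \<longleftrightarrow> (z, v) \<notin> parcs G)"
proof
  assume "strongly_resolves (with_proj G) z u v"
  then consider q where "shortest_path (with_proj G) z q u" "v \<in> set (pawalk_verts z q)"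
    | q where "shortest_path (with_proj G) z q v" "u \<in> set (pawalk_verts z q)"
    unfolding strongly_resolves_def awalk_verts_with_proj_eq by blast
  then show "(u, v) \<in> parcs G \<and> ((z, u) \<in> parcs G \<longleftrightarrow> (z, v) \<notin> parcs G)"
  proof cases
    case 1
    then have "(v, u) \<in> parcs G \<and> (z, v) \<in> parcs G \<and> (z, u) \<notin> parcs G"
      using assms(2-4) by (intro inner_vertex_of_shortest_path[OF assms(1)]) auto
    then show ?thesis
      using arc_sym by blast
  next
    case 2
    then have "(u, v) \<in> parcs G \<and> (z, u) \<in> parcs G \<and> (z, v) \<notin> parcs G"
      using assms(2-4) by (intro inner_vertex_of_shortest_path[OF assms(1)]) auto
    then show ?thesis by blast
  qed
next
  assume R: "(u, v) \<in> parcs G \<and> ((z, u) \<in> parcs G \<longleftrightarrow> (z, v) \<notin> parcs G)"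
  then have "(v, u) \<in> parcs G"
    using arc_sym by blast
  with R show "strongly_resolves (with_proj G) z u v"
    using strongly_resolves_if_arcs[of z v u] strongly_resolves_if_arcs[of z u v] assms(2,3)
      strongly_resolves_commute[of "with_proj G" z u v] by auto
qed

theorem strong_resolving_set_iff:
  assumes e: "e \<in> pverts G" and dom: "\<And>v. v \<in> pverts G \<Longrightarrow> v \<noteq> e \<Longrightarrow> (e, v) \<in> parcs G"
  shows "strong_resolving_set (with_proj G) U \<longleftrightarrow> U \<subseteq> pverts G \<and>
    (\<forall>u \<in> pverts G - U. \<forall>v \<in> pverts G - U. u \<noteq> v \<longrightarrow> (u, v) \<in> parcs G \<and>
      (\<exists>z\<in>U. (z, u) \<in> parcs G \<longleftrightarrow> (z, v) \<notin> parcs G))"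
    (is "?L \<longleftrightarrow> ?R")
proof
  assume L: ?L
  show ?R
  proof (intro conjI ballI impI)
    fix u v assume "u \<in> pverts G - U" "v \<in> pverts G - U" "u \<noteq> v"
    moreover from this L obtain z where "z \<in> U" "strongly_resolves (with_proj G) z u v"
      unfolding strong_resolving_set_def with_proj_simps by blast
    ultimately show "(u, v) \<in> parcs G" "\<exists>z\<in>U. (z, u) \<in> parcs G \<longleftrightarrow> (z, v) \<notin> parcs G"
      using strongly_resolves_iff[OF dom, of z u v] by auto
  qed (use L in \<open>auto simp: strong_resolving_set_def\<close>)
next
  assume R: ?R
  \<comment> \<open>Resolution by an endpoint requires some path between the two vertices;
    \<open>e\<close> supplies it.\<close>
  have conn: "\<exists>q. apath u q v" if "u \<in> pverts G" "v \<in> pverts G" "u \<noteq> v" for u v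
  proof (cases "u = e \<or> v = e")
    case True
    then have "(u, v) \<in> parcs G"
      using dom that arc_sym by blast
    then show ?thesis
      using apath_arc by blast
  next
    case False
    then show ?thesis
      using dom that arc_sym apath_two_arcs[of u e v] by blast
  qed
  have "\<exists>z\<in>U. strongly_resolves (with_proj G) z u v"
    if uv: "u \<in> pverts G" "v \<in> pverts G" "u \<noteq> v" for u v
  proof -
    consider "u \<in> U" | "v \<in> U" | "u \<notin> U" "v \<notin> U" by blast
    then show ?thesis
    proof cases
      case 1
      then show ?thesis
        using conn[OF uv] strongly_resolves_endpoint by blast
    next
      case 2
      then show ?thesis
        using conn[OF uv(2,1)] uv(3) strongly_resolves_endpoint strongly_resolves_commute by metis
    next
      case 3
      with R uv obtain z where "z \<in> U" "(u, v) \<in> parcs G" "(z, u) \<in> parcs G \<longleftrightarrow> (z, v) \<notin> parcs G"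
        by blast
      with 3 uv show ?thesis
        using strongly_resolves_iff[OF dom, of z u v] by auto
    qed
  qed
  with R show ?L
    by (simp add: strong_resolving_set_def)
qed

end

lemma strong_metric_dimension_eqI:
  assumes "strong_resolving_set \<Gamma> U" "finite U" "card U = n"
    and "\<And>V. strong_resolving_set \<Gamma> V \<Longrightarrow> finite V \<Longrightarrow> n \<le> card V"
  shows "strong_metric_dimension \<Gamma> = n"
  unfolding strong_metric_dimension_def using assms by (intro Least_equality) auto

section \<open>Cyclic subgroups of p-groups\<close>

context group
begin

lemma generate_singleton_subset:
  assumes "a \<in> carrier G" "b \<in> generate G {a}"
  shows "generate G {b} \<subseteq> generate G {a}"
  using assms by (intro generate_subgroup_incl generate_is_subgroup) auto

text \<open>The order of an element is the cardinality of the subgroup it generates, so inclusion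
  between finite sets and the bound on cardinalities give equality.\<close>

lemma generate_singleton_eqI:
  assumes "finite (carrier G)" "a \<in> carrier G" "b \<in> generate G {a}" "ord a \<le> ord b"
  shows "generate G {b} = generate G {a}"
proof -
  have b: "b \<in> carrier G"
    using assms(2,3) generate_in_carrier[of "{a}"] by auto
  have "finite (generate G {a})"
    using assms(1,2) generate_incl[of "{a}"] finite_subset by auto
  then show ?thesis
    using generate_singleton_subset[OF assms(2,3)] assms(2,4) b
    by (intro card_seteq) (auto simp: generate_pow_card)
qed

lemma pow_in_generate: "a \<in> carrier G \<Longrightarrow> a [^] (k::nat) \<in> generate G {a}"
  by (auto simp: generate_pow intro: exI[of _ "int k"] simp: int_pow_int)

lemma pow_in_generate_pow:
  assumes "a \<in> carrier G" "k dvd (l::nat)"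
  shows "a [^] l \<in> generate G {a [^] k}"
proof -
  from assms(2) obtain m where "l = k * m" by blast
  then have "a [^] l = (a [^] k) [^] m"
    using assms(1) by (simp add: nat_pow_pow)
  then show ?thesis
    using pow_in_generate assms(1) by simp
qed

text \<open>By Bezout the gcd is a combination of \<open>j\<close> and \<open>ord a\<close>, and the
  multiple of \<open>ord a\<close> contributes only the identity.\<close>

lemma pow_gcd_ord_in_generate:
  assumes "a \<in> carrier G"
  shows "a [^] gcd (j::nat) (ord a) \<in> generate G {a [^] j}"
proof -
  obtain s t where st: "s * int j + t * int (ord a) = gcd (int j) (int (ord a))"
    using bezout_int by blast
  have "a [^] gcd j (ord a) = a [^] (int j * s + int (ord a) * t)"
    using st by (simp add: mult.commute gcd_int_int_eq flip: int_pow_int)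
  also have "\<dots> = (a [^] j) [^] s"
    using assms by (simp add: int_pow_mult int_pow_int flip: int_pow_pow)
  finally show ?thesis
    using assms by (auto simp: generate_pow)
qed

text \<open>This is the fact that the subgroups of a cyclic p-group form a chain: an exponent may be
  replaced by its gcd with \<open>ord a\<close>, and these gcds are powers of \<open>p\<close>,
  hence comparable under divisibility.\<close>

lemma pows_comparable:
  assumes "prime p" "ord a = p ^ m" "a \<in> carrier G"
  shows "a [^] (i::nat) \<in> generate G {a [^] (j::nat)} \<or> a [^] j \<in> generate G {a [^] i}"
proof -
  have *: "a [^] i \<in> generate G {a [^] j}" if "gcd j (ord a) dvd gcd i (ord a)" for i j :: nat
  proof -
    have "a [^] i \<in> generate G {a [^] gcd j (ord a)}"
      using that assms(3) by (intro pow_in_generate_pow) auto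
    then show ?thesis
      using generate_singleton_subset[OF _ pow_gcd_ord_in_generate] assms(3) by blast
  qed
  obtain r s where "gcd i (ord a) = p ^ r" "gcd j (ord a) = p ^ s"
    using divides_primepow_nat[OF assms(1)] assms(2) gcd_dvd2 by metis
  then have "gcd j (ord a) dvd gcd i (ord a) \<or> gcd i (ord a) dvd gcd j (ord a)"
    by (metis le_imp_power_dvd nat_le_linear)
  then show ?thesis
    using * by blast
qed

lemma cyclic_subgroup_generator:
  assumes "subgroup H G" "cyclic_group (G\<lparr>carrier := H\<rparr>)"
  obtains h where "h \<in> H" "H = generate G {h}"
proof -
  from assms(2) obtain h where h: "h \<in> H"
    "subgroup_generated (G\<lparr>carrier := H\<rparr>) {h} = G\<lparr>carrier := H\<rparr>"
    by (auto simp: cyclic_group_def)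
  then have "carrier (subgroup_generated (G\<lparr>carrier := H\<rparr>) {h}) = H"
    by simp
  then have "generate (G\<lparr>carrier := H\<rparr>) {h} = H"
    using h(1) by (simp add: subgroup_generated_def)
  then show ?thesis
    using that h(1) generate_consistent[of "{h}" H] assms(1) by auto
qed

lemma cyclic_group_generate:
  assumes "a \<in> carrier G"
  shows "cyclic_group (G\<lparr>carrier := generate G {a}\<rparr>)"
  using cyclic_group_generated[of a] assms by (simp add: subgroup_generated_def)

text \<open>Used in contrapositive form: in a non-cyclic group, every cyclic subgroup misses some
  element.\<close>

lemma generator_imp_cyclic_group:
  assumes "a \<in> carrier G" "carrier G \<subseteq> generate G {a}"
  shows "cyclic_group G"
proof -
  have "generate G {a} = carrier G"
    using assms generate_incl[of "{a}"] by auto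
  then have "subgroup_generated G {a} = G"
    using assms(1) by (simp add: subgroup_generated_def)
  then show ?thesis
    using assms(1) by (auto simp: cyclic_group_def)
qed

text \<open>Members of a common cyclic subgroup are powers of one generator, whose order is a power
  of \<open>p\<close>, so \<open>pows_comparable\<close> applies. Conversely, the larger of two
  nested cyclic subgroups contains both vertices.\<close>

theorem enhanced_power_graph_arc_iff:
  assumes "prime p" "finite (carrier G)" "order G = p ^ n"
    and xy: "x \<in> carrier G" "y \<in> carrier G"
  shows "(x, y) \<in> parcs (enhanced_power_graph G) \<longleftrightarrow>
    x \<noteq> y \<and> (x \<in> generate G {y} \<or> y \<in> generate G {x})"
proof
  assume "(x, y) \<in> parcs (enhanced_power_graph G)"
  then obtain H where H: "subgroup H G" "cyclic_group (G\<lparr>carrier := H\<rparr>)" "x \<in> H" "y \<in> H"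
    and "x \<noteq> y"
    by (auto simp: enhanced_power_graph_def)
  obtain h where h: "h \<in> H" "H = generate G {h}"
    using cyclic_subgroup_generator[OF H(1,2)] by blast
  have hc: "h \<in> carrier G"
    using h(1) H(1) by (rule subgroup.mem_carrier[rotated])
  obtain i j :: nat where "x = h [^] i" "y = h [^] j"
    using H(3,4) h(2) generate_pow_on_finite_carrier[OF assms(2) hc] by auto
  moreover obtain m where "ord h = p ^ m"
    using ord_dvd_group_order[OF hc] assms(1,3) divides_primepow_nat by metis
  ultimately show "x \<noteq> y \<and> (x \<in> generate G {y} \<or> y \<in> generate G {x})"
    using pows_comparable[OF assms(1) _ hc] \<open>x \<noteq> y\<close> by blast
next
  assume R: "x \<noteq> y \<and> (x \<in> generate G {y} \<or> y \<in> generate G {x})"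
  have "\<exists>a\<in>carrier G. x \<in> generate G {a} \<and> y \<in> generate G {a}"
    using R xy generate.incl[of _ "{x}"] generate.incl[of _ "{y}"] by blast
  then obtain a where "a \<in> carrier G" "x \<in> generate G {a}" "y \<in> generate G {a}"
    by blast
  moreover from this have "subgroup (generate G {a}) G"
    by (intro generate_is_subgroup) auto
  ultimately show "(x, y) \<in> parcs (enhanced_power_graph G)"
    using R xy cyclic_group_generate by (auto simp: enhanced_power_graph_def)
qed

section \<open>Elements of maximal order and elements killed by p\<close>

text \<open>All orders are powers of \<open>p\<close>, so the largest one is a multiple of every
  other and equals their least common multiple.\<close>

lemma exists_ord_eq_exponent:
  assumes "prime p" "finite (carrier G)" "order G = p ^ n" "group_exponent G = p ^ \<alpha>"
  shows "\<exists>x\<in>carrier G. ord x = p ^ \<alpha>"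
proof -
  have "finite (ord ` carrier G)" "ord ` carrier G \<noteq> {}"
    using assms(2) by auto
  from Max_in[OF this] obtain x where x: "x \<in> carrier G" "ord x = Max (ord ` carrier G)"
    by (metis imageE)
  have "ord y dvd ord x" if y: "y \<in> carrier G" for y
  proof -
    have "ord y \<le> ord x"
      using assms(2) x(2) y by simp
    moreover obtain k l where "ord y = p ^ k" "ord x = p ^ l"
      using ord_dvd_group_order x(1) y assms(1,3) divides_primepow_nat by metis
    ultimately show ?thesis
      using prime_gt_1_nat[OF assms(1)] by (simp add: le_imp_power_dvd)
  qed
  then have "group_exponent G dvd ord x"
    unfolding group_exponent_def by (auto intro: Lcm_least)
  moreover have "ord x dvd group_exponent G"
    unfolding group_exponent_def using x(1) by (auto intro: dvd_Lcm)
  ultimately show ?thesis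
    using x(1) assms(4) dvd_antisym by metis
qed

end

lemma (in comm_group) exists_ord_prime_outside_maximal_cyclic:
  assumes p: "prime p" and fin: "finite (carrier G)"
    and x: "x \<in> carrier G" "ord x = p ^ \<alpha>"
    and exp: "\<And>g. g \<in> carrier G \<Longrightarrow> g [^] (p ^ \<alpha>) = \<one>"
    and ncyc: "\<not> cyclic_group G"
  shows "\<exists>y\<in>carrier G. y \<notin> generate G {x} \<and> y [^] p = \<one>"
proof -
  let ?C = "generate G {x}"
  have C: "subgroup ?C G"
    using x(1) by (intro generate_is_subgroup) auto
  obtain h where h: "h \<in> carrier G" "h \<notin> ?C"
    using generator_imp_cyclic_group[OF x(1)] ncyc by blast
  \<comment> \<open>The iterated \<open>p\<close>-th powers of \<open>h\<close> start outside
    \<open>?C\<close> and reach \<open>\<one>\<close> in it. The last iterate still outside is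
    \<open>g\<close>, so that \<open>g [^] p\<close> lies in \<open>?C\<close>.\<close>
  define k where "k = (LEAST k. h [^] (p ^ k) \<in> ?C)"
  have ex: "h [^] (p ^ \<alpha>) \<in> ?C"
    using exp[OF h(1)] subgroup.one_closed[OF C] by simp
  have k: "h [^] (p ^ k) \<in> ?C"
    unfolding k_def by (rule LeastI[of "\<lambda>k. h [^] (p ^ k) \<in> ?C", OF ex])
  have kle: "k \<le> \<alpha>"
    unfolding k_def by (rule Least_le[of "\<lambda>k. h [^] (p ^ k) \<in> ?C", OF ex])
  have "k \<noteq> 0"
    using k h by (intro notI) simp
  then obtain k' where k': "k = Suc k'"
    using not0_implies_Suc by blast
  define g where "g = h [^] (p ^ k')"
  have gC: "g \<notin> ?C"
    using not_less_Least[of k' "\<lambda>k. h [^] (p ^ k) \<in> ?C"] k' unfolding g_def k_def by auto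
  have g: "g \<in> carrier G"
    using h(1) by (simp add: g_def)
  have "g [^] p \<in> ?C"
    using k h(1) by (simp add: g_def k' nat_pow_pow mult.commute)
  then obtain m :: nat where m: "g [^] p = x [^] m"
    using generate_pow_on_finite_carrier[OF fin x(1)] by auto
  obtain \<beta> where \<beta>: "\<alpha> = Suc \<beta>"
    using kle k' by (cases \<alpha>) auto
  \<comment> \<open>Raising \<open>g [^] p = x [^] m\<close> to the power \<open>p ^ \<beta>\<close>
    gives the identity, which forces \<open>p\<close> to divide \<open>m\<close>.\<close>
  have "x [^] (m * p ^ \<beta>) = g [^] (p ^ \<alpha>)"
    using g x(1) m by (simp add: \<beta> flip: nat_pow_pow)
  then have "p ^ \<alpha> dvd m * p ^ \<beta>"
    using exp[OF g] x pow_eq_id by metis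
  then have "p dvd m"
    using prime_gt_0_nat[OF p] by (simp add: \<beta>)
  then obtain m' where m': "m = m' * p"
    by (metis dvdE mult.commute)
  \<comment> \<open>Since \<open>x [^] m'\<close> is a \<open>p\<close>-th root of
    \<open>g [^] p\<close> inside \<open>?C\<close>, dividing \<open>g\<close> by it kills the
    \<open>p\<close>-th power, by commutativity, without leaving the coset of
    \<open>g\<close>.\<close>
  define y where "y = g \<otimes> inv (x [^] m')"
  have xm: "x [^] m' \<in> ?C" "x [^] m' \<in> carrier G"
    using pow_in_generate x(1) by auto
  have "y [^] p = g [^] p \<otimes> inv ((x [^] m') [^] p)"
    using g xm(2) by (simp add: y_def nat_pow_distrib nat_pow_inv)
  also have "\<dots> = \<one>"
    using x(1) m m' by (simp add: nat_pow_pow)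
  finally have "y [^] p = \<one>" .
  moreover have "y \<notin> ?C"
  proof
    assume "y \<in> ?C"
    then have "y \<otimes> x [^] m' \<in> ?C"
      using xm C by (simp add: subgroup.m_closed)
    then show False
      using gC g xm(2) by (simp add: y_def m_assoc)
  qed
  moreover have "y \<in> carrier G"
    using g xm(2) by (simp add: y_def)
  ultimately show ?thesis by blast
qed

section \<open>The strong metric dimension\<close>

locale finite_abelian_p_group = comm_group +
  fixes p n \<alpha> :: nat
  assumes p: "prime p" and fin: "finite (carrier G)" and order: "order G = p ^ n"
    and exponent: "group_exponent G = p ^ \<alpha>"
begin

abbreviation "\<Gamma> \<equiv> enhanced_power_graph G"

sublocale \<Gamma>: pair_graph \<Gamma>
  using fin by (rule pair_graph_enhanced_power_graph)

lemma verts: "pverts \<Gamma> = carrier G"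
  by (simp add: enhanced_power_graph_def)

lemmas arc_iff = enhanced_power_graph_arc_iff[OF p fin order]

lemma one_dominates: "v \<in> carrier G \<Longrightarrow> v \<noteq> \<one> \<Longrightarrow> (\<one>, v) \<in> parcs \<Gamma>"
  by (auto simp: arc_iff intro: generate.one)

lemma strong_resolving_set_iff:
  "strong_resolving_set (with_proj \<Gamma>) U \<longleftrightarrow> U \<subseteq> carrier G \<and>
    (\<forall>u \<in> carrier G - U. \<forall>v \<in> carrier G - U. u \<noteq> v \<longrightarrow> (u, v) \<in> parcs \<Gamma> \<and>
      (\<exists>z\<in>U. (z, u) \<in> parcs \<Gamma> \<longleftrightarrow> (z, v) \<notin> parcs \<Gamma>))"
  using \<Gamma>.strong_resolving_set_iff[of "\<one>" U] one_dominates by (simp add: verts)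

lemma ord_dvd_exponent: "g \<in> carrier G \<Longrightarrow> ord g dvd p ^ \<alpha>"
  using exponent unfolding group_exponent_def by (metis dvd_Lcm imageI)

section \<open>Lower bound through the orders of the elements\<close>

text \<open>Adjacent vertices of equal order generate the same cyclic subgroup. They then have the
  same neighbours apart from each other, and no \<open>z\<close> separates them.\<close>

lemma ord_inj_on_complement:
  assumes U: "strong_resolving_set (with_proj \<Gamma>) U"
  shows "inj_on ord (carrier G - U)"
proof (rule inj_onI, rule ccontr)
  fix u v assume uv: "u \<in> carrier G - U" "v \<in> carrier G - U" "ord u = ord v" "u \<noteq> v"
  then obtain z where z: "z \<in> U" "(z, u) \<in> parcs \<Gamma> \<longleftrightarrow> (z, v) \<notin> parcs \<Gamma>"
    and adj: "(u, v) \<in> parcs \<Gamma>"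
    using U unfolding strong_resolving_set_iff by blast
  have zc: "z \<in> carrier G"
    using U z(1) by (auto simp: strong_resolving_set_iff)
  have eq: "generate G {u} = generate G {v}"
  proof -
    have c: "u \<in> carrier G" "v \<in> carrier G"
      using uv by auto
    then consider "u \<in> generate G {v}" | "v \<in> generate G {u}"
      using adj arc_iff by blast
    then show ?thesis
      using generate_singleton_eqI[OF fin c(2), of u] generate_singleton_eqI[OF fin c(1), of v] uv(3)
      by (cases; metis order_refl)
  qed
  have mem: "u \<in> generate G {z} \<longleftrightarrow> v \<in> generate G {z}"
    using eq generate_singleton_subset[OF zc] generate.incl[of _ "{u}" G] generate.incl[of _ "{v}" G]
    by blast
  have "z \<noteq> u" "z \<noteq> v"
    using z(1) uv by auto
  then show False
    using z(2) eq mem uv zc by (auto simp: arc_iff)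
qed

text \<open>Orders divide \<open>p ^ \<alpha>\<close> and so take at most \<alpha> + 1 values; by
  injectivity of \<open>ord\<close> this bounds the complement.\<close>

lemma card_strong_resolving_set_ge:
  assumes U: "strong_resolving_set (with_proj \<Gamma>) U"
  shows "order G - (\<alpha> + 1) \<le> card U"
proof -
  have "ord ` (carrier G - U) \<subseteq> (\<lambda>i. p ^ i) ` {..\<alpha>}"
  proof
    fix d assume "d \<in> ord ` (carrier G - U)"
    then have "d dvd p ^ \<alpha>"
      using ord_dvd_exponent by auto
    then show "d \<in> (\<lambda>i. p ^ i) ` {..\<alpha>}"
      using divides_primepow_nat[OF p] by auto
  qed
  then have "card (ord ` (carrier G - U)) \<le> card ((\<lambda>i. p ^ i) ` {..\<alpha>})"
    by (intro card_mono) auto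
  also have "\<dots> \<le> \<alpha> + 1"
    using card_image_le[of "{..\<alpha>}" "\<lambda>i. p ^ i"] by simp
  finally have "card (carrier G - U) \<le> \<alpha> + 1"
    by (simp add: card_image[OF ord_inj_on_complement[OF U]])
  moreover have "card (carrier G - U) = order G - card U"
    using U fin by (auto simp: strong_resolving_set_iff order_def card_Diff_subset finite_subset)
  ultimately show ?thesis by simp
qed

theorem strong_metric_dimension_noncyclic:
  assumes ncyc: "\<not> cyclic_group G"
  shows "int (strong_metric_dimension (with_proj \<Gamma>)) = int (order G) - (int \<alpha> + 1)"
proof -
  obtain x where x: "x \<in> carrier G" "ord x = p ^ \<alpha>"
    using exists_ord_eq_exponent[OF p fin order exponent] by blast
  have "g [^] (p ^ \<alpha>) = \<one>" if "g \<in> carrier G" for g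
    using ord_dvd_exponent[OF that] that pow_eq_id by blast
  then obtain y where y: "y \<in> carrier G" "y \<notin> generate G {x}" "y [^] p = \<one>"
    using exists_ord_prime_outside_maximal_cyclic[OF p fin x _ ncyc] by blast
  \<comment> \<open>These elements have the orders \<open>p ^ (\<alpha> - k)\<close>, one for each
    possible order, and generate a descending chain of subgroups.\<close>
  define w where "w k = x [^] (p ^ k)" for k
  have wc: "w k \<in> carrier G" and wx: "w k \<in> generate G {x}" for k
    using x(1) pow_in_generate by (auto simp: w_def)
  have ord_w: "ord (w k) = p ^ (\<alpha> - k)" if "k \<le> \<alpha>" for k
    using that x p prime_gt_0_nat[OF p]
    by (simp add: w_def ord_pow le_imp_power_dvd power_diff)
  have inj: "inj_on w {..\<alpha>}"
  proof (rule inj_onI)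
    fix k l assume kl: "k \<in> {..\<alpha>}" "l \<in> {..\<alpha>}" "w k = w l"
    then have "p ^ (\<alpha> - k) = p ^ (\<alpha> - l)"
      using ord_w by (metis atMost_iff)
    then show "k = l"
      using kl prime_gt_1_nat[OF p] by auto
  qed
  define U where "U = carrier G - w ` {..\<alpha>}"
  have sub: "w ` {..\<alpha>} \<subseteq> carrier G"
    using wc by auto
  have cardw: "card (w ` {..\<alpha>}) = \<alpha> + 1"
    by (simp add: card_image[OF inj])
  have cardU: "card U = order G - (\<alpha> + 1)"
    using sub cardw by (simp add: U_def card_Diff_subset order_def)
  have resolve: "(w k, w l) \<in> parcs \<Gamma> \<and> (\<exists>z\<in>U. (z, w l) \<in> parcs \<Gamma> \<and> (z, w k) \<notin> parcs \<Gamma>)"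
    if kl: "k < l" "l \<le> \<alpha>" for k l
  proof -
    \<comment> \<open>A second \<open>p\<close>-th root of \<open>w l\<close>, moved out of
      \<open>generate G {x}\<close> by \<open>y\<close>. Here \<open>k < l\<close> ensures that
      \<open>l - 1\<close> is a true predecessor.\<close>
    define z where "z = w (l - 1) \<otimes> y"
    have zc: "z \<in> carrier G"
      using wc y by (simp add: z_def)
    have zx: "z \<notin> generate G {x}"
    proof
      assume "z \<in> generate G {x}"
      moreover have C: "subgroup (generate G {x}) G"
        using x(1) by (intro generate_is_subgroup) auto
      ultimately have "inv (w (l - 1)) \<otimes> z \<in> generate G {x}"
        using wx by (simp add: subgroup.m_closed subgroup.m_inv_closed)
      moreover have "inv (w (l - 1)) \<otimes> z = y"
        using wc y(1) by (simp add: z_def flip: m_assoc)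
      ultimately show False
        using y(2) by simp
    qed
    have zU: "z \<in> U"
      using zc zx wx by (auto simp: U_def)
    have "(w (l - 1)) [^] p = w l"
      using x(1) kl(1) by (simp add: w_def nat_pow_pow flip: power_Suc2)
    then have zp: "z [^] p = w l"
      using wc y by (simp add: z_def nat_pow_distrib)
    have "w l \<in> generate G {z}"
      using pow_in_generate[OF zc, of p] zp by simp
    moreover have "z \<noteq> w l"
      using zx wx by metis
    ultimately have "(z, w l) \<in> parcs \<Gamma>"
      using zc wc by (simp add: arc_iff)
    moreover have "(z, w k) \<notin> parcs \<Gamma>"
    proof
      assume "(z, w k) \<in> parcs \<Gamma>"
      moreover have wk: "generate G {w k} \<subseteq> generate G {x}"
        using generate_singleton_subset x(1) wx by blast
      ultimately have mem: "w k \<in> generate G {z}"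
        using zc wc zx by (auto simp: arc_iff)
      \<comment> \<open>The order of \<open>z\<close> is now bounded by that of \<open>w k\<close>.
        With \<open>mem\<close>, both generate the same subgroup, which would put \<open>z\<close>
        into \<open>generate G {x}\<close>.\<close>
      have "z [^] (p * p ^ (\<alpha> - l)) = w l [^] p ^ (\<alpha> - l)"
        using zc zp by (simp flip: nat_pow_pow)
      also have "\<dots> = \<one>"
        using ord_w[OF kl(2)] wc pow_ord_eq_1 by metis
      finally have "ord z dvd p ^ Suc (\<alpha> - l)"
        using pow_eq_id zc by simp
      then have "ord z \<le> p ^ Suc (\<alpha> - l)"
        using prime_gt_0_nat[OF p] by (intro dvd_imp_le) auto
      also have "\<dots> \<le> p ^ (\<alpha> - k)"
        using kl prime_gt_0_nat[OF p] by (intro power_increasing) auto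
      also have "\<dots> = ord (w k)"
        using ord_w kl by simp
      finally have "generate G {w k} = generate G {z}"
        by (rule generate_singleton_eqI[OF fin zc mem])
      then show False
        using wk zx generate.incl[of z "{z}" G] by blast
    qed
    moreover have "w l \<in> generate G {w k}"
      unfolding w_def using x(1) kl by (intro pow_in_generate_pow) (auto simp: le_imp_power_dvd)
    moreover have "w k \<noteq> w l"
      using inj_onD[OF inj] kl by force
    ultimately show ?thesis
      using zU wc by (auto simp: arc_iff)
  qed
  have "strong_resolving_set (with_proj \<Gamma>) U"
    unfolding strong_resolving_set_iff
  proof (intro conjI ballI impI)
    show "U \<subseteq> carrier G"
      by (auto simp: U_def)
    fix u v assume "u \<in> carrier G - U" "v \<in> carrier G - U" and uv: "u \<noteq> v"
    then obtain k l where kl: "u = w k" "v = w l" "k \<le> \<alpha>" "l \<le> \<alpha>"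
      by (auto simp: U_def)
    then consider "k < l" | "l < k"
      using uv by (metis nat_neq_iff)
    then have "(u, v) \<in> parcs \<Gamma> \<and> (\<exists>z\<in>U. (z, u) \<in> parcs \<Gamma> \<longleftrightarrow> (z, v) \<notin> parcs \<Gamma>)"
    proof cases
      case 1
      then show ?thesis
        using resolve[of k l] kl by auto
    next
      case 2
      then show ?thesis
        using resolve[of l k] kl \<Gamma>.arc_sym by auto
    qed
    then show "(u, v) \<in> parcs \<Gamma>" "\<exists>z\<in>U. (z, u) \<in> parcs \<Gamma> \<longleftrightarrow> (z, v) \<notin> parcs \<Gamma>"
      by auto
  qed
  then have "strong_metric_dimension (with_proj \<Gamma>) = order G - (\<alpha> + 1)"
    using cardU fin by (intro strong_metric_dimension_eqI card_strong_resolving_set_ge) (auto simp: U_def)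
  \<comment> \<open>This rules out truncation in the natural subtraction before passing to
    integers.\<close>
  moreover have "\<alpha> + 1 \<le> order G"
    using card_mono[OF fin sub] cardw by (simp add: order_def)
  ultimately show ?thesis
    by simp
qed

text \<open>With the whole group as the common cyclic subgroup the graph is complete, so no third
  vertex separates two others and the complement of a strong resolving set has at most one
  element.\<close>

theorem strong_metric_dimension_cyclic:
  assumes "cyclic_group G"
  shows "int (strong_metric_dimension (with_proj \<Gamma>)) = int (order G) - 1"
proof -
  have complete: "(u, v) \<in> parcs \<Gamma> \<longleftrightarrow> u \<noteq> v" if "u \<in> carrier G" "v \<in> carrier G" for u v
    using that assms subgroup_self by (auto simp: enhanced_power_graph_def)
  have pos: "0 < order G"
    using fin order_gt_0_iff_finite by blast
  have "strong_metric_dimension (with_proj \<Gamma>) = order G - 1"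
  proof (rule strong_metric_dimension_eqI)
    \<comment> \<open>Only one vertex is left out, so there is no pair to separate.\<close>
    show "strong_resolving_set (with_proj \<Gamma>) (carrier G - {\<one>})"
      by (auto simp: strong_resolving_set_iff)
    show "card (carrier G - {\<one>}) = order G - 1"
      by (simp add: order_def)
    fix V assume V: "strong_resolving_set (with_proj \<Gamma>) V" and "finite V"
    have "u = v" if uv: "u \<in> carrier G - V" "v \<in> carrier G - V" for u v
    proof (rule ccontr)
      assume "u \<noteq> v"
      with V uv obtain z where "z \<in> V" "(z, u) \<in> parcs \<Gamma> \<longleftrightarrow> (z, v) \<notin> parcs \<Gamma>"
        unfolding strong_resolving_set_iff by blast
      moreover from this(1) V have "z \<in> carrier G"
        unfolding strong_resolving_set_iff by blast
      ultimately show False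
        using uv complete[of z u] complete[of z v] by auto
    qed
    then have "card (carrier G - V) \<le> 1"
      using fin by (subst card_le_Suc0_iff_eq[folded One_nat_def]) auto
    then show "order G - 1 \<le> card V"
      using V \<open>finite V\<close> by (auto simp: strong_resolving_set_iff order_def card_Diff_subset)
  qed (use fin in auto)
  with pos show ?thesis by simp
qed

end

theorem theorem3p13:
  fixes G :: "('a, 'b) monoid_scheme" and p \<alpha> :: nat
  assumes "prime p"
    and "comm_group G"
    and "finite (carrier G)"
    and "\<exists>n. order G = p ^ n"
    and "group_exponent G = p ^ \<alpha>"
  shows "(\<not> cyclic_group G \<longrightarrow>
           int (strong_metric_dimension (with_proj (enhanced_power_graph G)))
             = int (order G) - (int \<alpha> + 1)) \<and>
         (cyclic_group G \<longrightarrow>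
           int (strong_metric_dimension (with_proj (enhanced_power_graph G)))
             = int (order G) - 1)"
proof -
  obtain n where "order G = p ^ n"
    using assms(4) by blast
  then interpret finite_abelian_p_group G p n \<alpha>
    using assms by (simp add: finite_abelian_p_group_def finite_abelian_p_group_axioms_def)
  show ?thesis
    using strong_metric_dimension_noncyclic strong_metric_dimension_cyclic by blast
qed

end
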